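(* (Soundness.) Let $r\in\{f,\beta\}$. If $M:\langle (x_i:U_i)_n\vdash U\rangle$ is derivable, $\mathcal I$ is an $r$-interpretation, and $N_i\in\mathcal I(U_i)$ for every $1\le i\le n$, then $M[(x_i:=N_i)_1^n]\in\mathcal I(U)$.
   Context: Terms: $\mathcal V$ is a denumerably infinite set of variables; $\mathcal M$ is the set of untyped $\lambda$-terms $M::=x\mid \lambda x.M\mid MM$ taken modulo $\alpha$-conversion; $FV(M)$ is the set of free variables; $M[(x_i:=N_i)_1^n]$ is simultaneous capture-avoiding substitution. $\rhd_\beta$ is the compatible closure of $(\lambda x.M)N\rhd_\beta M[x:=N]$. Weak head reduction: $M\rhd_f N$ iff $M=(\lambda x.P)QQ_1\dots Q_n$ and $N=P[x:=Q]Q_1\dots Q_n$ for some $n\ge 0$. $\rhd_r^*$ is the reflexive-transitive closure of $\rhd_r$. Types: $\mathcal A$ is a denumerably infinite set of atomic types; $\mathbb T::=a\mid \mathbb U\to\mathbb T$ ($a\in\mathcal A$) and $\mathbb U::=\omega\mid \mathbb U\sqcap\mathbb U\mid \mathbb T$; types are quotiented by commutativity, associativity and idempotence of $\sqcap$ and by $\omega\sqcap U=U$. $T$ ranges over $\mathbb T$, $U,V$ over $\mathbb U$. Environments: a type environment is a finite set $(x_i:U_i)_n$ of declarations with pairwise distinct variables; $dom$ is its set of variables; $()$ is the empty environment; $\Gamma,x:U$ requires $x\notin dom(\Gamma)$; $env^M_\omega$ assigns $\omega$ to each variable of $FV(M)$ and nothing else; if $\Gamma_1=(x_i:U_i)_n,(y_j:V_j)_m$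 and $\Gamma_2=(x_i:U'_i)_n,(z_k:W_k)_l$ with the $y_j$, $z_k$ all distinct, then $\Gamma_1\sqcap\Gamma_2=(x_i:U_i\sqcap U'_i)_n,(y_j:V_j)_m,(z_k:W_k)_l$. Subtyping: $\sqsubseteq$ (on types, on environments, and on typings $\langle\Gamma\vdash U\rangle$) is the least relation closed under: $\Phi\sqsubseteq\Phi$; transitivity; $U_1\sqcap U_2\sqsubseteq U_1$; if $U_1\sqsubseteq V_1$ and $U_2\sqsubseteq V_2$ then $U_1\sqcap U_2\sqsubseteq V_1\sqcap V_2$; if $U_2\sqsubseteq U_1$ and $T_1\sqsubseteq T_2$ then $U_1\to T_1\sqsubseteq U_2\to T_2$; if $U_1\sqsubseteq U_2$ and $x\notin dom(\Gamma)$ then $\Gamma,x:U_1\sqsubseteq\Gamma,x:U_2$; if $U_1\sqsubseteq U_2$ and $\Gamma_2\sqsubseteq\Gamma_1$ then $\langle\Gamma_1\vdash U_1\rangle\sqsubseteq\langle\Gamma_2\vdash U_2\rangle$. Typing rules for $M:\langle\Gamma\vdash U\rangle$: (ax) $x:\langle x:T\vdash T\rangle$ for $T\in\mathbb T$; ($\omega$) $M:\langle env^M_\omega\vdash\omega\rangle$; ($\to_i$) from $M:\langle\Gamma,x:U\vdash T\rangle$ infer $\lambda x.M:\langle\Gamma\vdash U\to T\rangle$; ($\to'_i$) from $M:\langle\Gamma\vdash T\rangle$ and $x\notin dom(\Gamma)$ infer $\lambda x.M:\langle\Gamma\vdash\omega\to T\rangle$; ($\to_e$) from $M_1:\langle\Gamma_1\vdash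 U\to T\rangle$ and $M_2:\langle\Gamma_2\vdash U\rangle$ infer $M_1M_2:\langle\Gamma_1\sqcap\Gamma_2\vdash T\rangle$; ($\sqcap_i$) from $M:\langle\Gamma\vdash U_1\rangle$ and $M:\langle\Gamma\vdash U_2\rangle$ infer $M:\langle\Gamma\vdash U_1\sqcap U_2\rangle$; ($\sqsubseteq$) from $M:\langle\Gamma\vdash U\rangle$ and $\langle\Gamma\vdash U\rangle\sqsubseteq\langle\Gamma'\vdash U'\rangle$ infer $M:\langle\Gamma'\vdash U'\rangle$. Semantics: for $\mathcal X,\mathcal Y\subseteq\mathcal M$, $\mathcal X\leadsto\mathcal Y=\{M\in\mathcal M\mid MN\in\mathcal Y\text{ for all }N\in\mathcal X\}$. For $r\in\{f,\beta\}$, $\mathcal X$ is $r$-saturated if $M\rhd_r^*N$ and $N\in\mathcal X$ imply $M\in\mathcal X$. An $r$-interpretation is a function $\mathcal I:\mathcal A\to\mathcal P(\mathcal M)$ with every $\mathcal I(a)$ $r$-saturated, extended to $\mathbb U$ by $\mathcal I(\omega)=\mathcal M$, $\mathcal I(U_1\sqcap U_2)=\mathcal I(U_1)\cap\mathcal I(U_2)$, $\mathcal I(U\to T)=\mathcal I(U)\leadsto\mathcal I(T)$. *)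

theory Defs
  imports Main "HOL-Library.Finite_Map"
begin

type_synonym var = nat

datatype rtm = RVar var | RLam var rtm | RApp rtm rtm

primrec rfv :: "rtm \<Rightarrow> var set" where
  "rfv (RVar x) = {x}"
| "rfv (RLam x M) = rfv M - {x}"
| "rfv (RApp M N) = rfv M \<union> rfv N"

lemma finite_rfv [simp]: "finite (rfv M)"
  by (induction M) auto

definition fresh :: "var set \<Rightarrow> var" where
  "fresh A = (SOME z. z \<notin> A)"

lemma fresh_notin: "finite A \<Longrightarrow> fresh A \<notin> A"
  unfolding fresh_def by (rule someI_ex) (simp add: ex_new_if_finite)

text \<open>Simultaneous capture-avoiding substitution, in the style of Stoughton: every binder is
  renamed to a variable that occurs free in none of the terms substituted below it, which makes the
  recursion structural.\<close>

primrec rsubst :: "rtm \<Rightarrow> (var \<Rightarrow> rtm) \<Rightarrow> rtm" where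
  "rsubst (RVar x) \<sigma> = \<sigma> x"
| "rsubst (RLam x M) \<sigma> =
     (let z = fresh (\<Union>y \<in> rfv M - {x}. rfv (\<sigma> y)) in RLam z (rsubst M (\<sigma>(x := RVar z))))"
| "rsubst (RApp M N) \<sigma> = RApp (rsubst M \<sigma>) (rsubst N \<sigma>)"

inductive alpha :: "rtm \<Rightarrow> rtm \<Rightarrow> bool" where
  alpha_refl: "alpha M M"
| alpha_sym: "alpha M N \<Longrightarrow> alpha N M"
| alpha_trans: "alpha M N \<Longrightarrow> alpha N P \<Longrightarrow> alpha M P"
| alpha_lam: "alpha M N \<Longrightarrow> alpha (RLam x M) (RLam x N)"
| alpha_app: "alpha M M' \<Longrightarrow> alpha N N' \<Longrightarrow> alpha (RApp M N) (RApp M' N')"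
| alpha_rename: "y \<notin> rfv M \<Longrightarrow> alpha (RLam x M) (RLam y (rsubst M (RVar(x := RVar y))))"

lemma rfv_rsubst: "rfv (rsubst M \<sigma>) = (\<Union>y \<in> rfv M. rfv (\<sigma> y))"
proof (induction M arbitrary: \<sigma>)
  case (RLam x M)
  let ?A = "\<Union>y \<in> rfv M - {x}. rfv (\<sigma> y)"
  have "fresh ?A \<notin> ?A" by (rule fresh_notin) simp
  then show ?case
    using RLam.IH by (auto simp: Let_def split: if_splits)
qed auto

lemma rsubst_cong:
  "(\<And>y. y \<in> rfv M \<Longrightarrow> \<sigma> y = \<tau> y) \<Longrightarrow> rsubst M \<sigma> = rsubst M \<tau>"
proof (induction M arbitrary: \<sigma> \<tau>)
  case (RLam x M)
  have "(\<Union>y \<in> rfv M - {x}. rfv (\<sigma> y)) = (\<Union>y \<in> rfv M - {x}. rfv (\<tau> y))"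
    using RLam.prems by auto
  moreover have "rsubst M (\<sigma>(x := RVar z)) = rsubst M (\<tau>(x := RVar z))" for z
    by (rule RLam.IH) (use RLam.prems in auto)
  ultimately show ?case by (simp add: Let_def)
next
  case (RApp M N)
  have "rsubst M \<sigma> = rsubst M \<tau>" "rsubst N \<sigma> = rsubst N \<tau>"
    by (rule RApp.IH; use RApp.prems in auto)+
  then show ?case by simp
qed auto

lemma rsubst_rsubst: "rsubst (rsubst M \<sigma>) \<tau> = rsubst M (\<lambda>y. rsubst (\<sigma> y) \<tau>)"
proof (induction M arbitrary: \<sigma> \<tau>)
  case (RLam x M)
  define A where "A = (\<Union>y \<in> rfv M - {x}. rfv (\<sigma> y))"
  define z where "z = fresh A"
  have z: "z \<notin> A" unfolding z_def by (rule fresh_notin) (simp add: A_def)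
  define M' where "M' = rsubst M (\<sigma>(x := RVar z))"
  have A: "rfv M' - {z} = A"
    using z by (auto simp: M'_def rfv_rsubst A_def split: if_splits)
  define z' where "z' = fresh (\<Union>y \<in> A. rfv (\<tau> y))"
  have B: "(\<Union>y \<in> rfv M - {x}. rfv (rsubst (\<sigma> y) \<tau>)) = (\<Union>y \<in> A. rfv (\<tau> y))"
    by (auto simp: A_def rfv_rsubst)
  have "rsubst M' (\<tau>(z := RVar z')) = rsubst M (\<lambda>y. rsubst ((\<sigma>(x := RVar z)) y) (\<tau>(z := RVar z')))"
    unfolding M'_def by (rule RLam.IH)
  also have "\<dots> = rsubst M ((\<lambda>y. rsubst (\<sigma> y) \<tau>)(x := RVar z'))"
  proof (rule rsubst_cong)
    fix y assume y: "y \<in> rfv M"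
    show "rsubst ((\<sigma>(x := RVar z)) y) (\<tau>(z := RVar z')) = ((\<lambda>y. rsubst (\<sigma> y) \<tau>)(x := RVar z')) y"
    proof (cases "y = x")
      case False
      then have "z \<notin> rfv (\<sigma> y)" using y z by (auto simp: A_def)
      then have "rsubst (\<sigma> y) (\<tau>(z := RVar z')) = rsubst (\<sigma> y) \<tau>"
        by (intro rsubst_cong) auto
      then show ?thesis using False by simp
    qed simp
  qed
  finally have C: "rsubst M' (\<tau>(z := RVar z')) = rsubst M ((\<lambda>y. rsubst (\<sigma> y) \<tau>)(x := RVar z'))" .
  have "rsubst (RLam x M) \<sigma> = RLam z M'"
    unfolding rsubst.simps Let_def A_def[symmetric] z_def[symmetric] M'_def[symmetric] ..
  then have "rsubst (rsubst (RLam x M) \<sigma>) \<tau> = RLam z' (rsubst M' (\<tau>(z := RVar z')))"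
    by (simp only: rsubst.simps Let_def A z'_def)
  also have "\<dots> = RLam z' (rsubst M ((\<lambda>y. rsubst (\<sigma> y) \<tau>)(x := RVar z')))"
    unfolding C ..
  also have "\<dots> = rsubst (RLam x M) (\<lambda>y. rsubst (\<sigma> y) \<tau>)"
    unfolding z'_def B[symmetric] rsubst.simps(2) Let_def ..
  finally show ?case .
qed auto

lemma alpha_rfv: "alpha M N \<Longrightarrow> rfv M = rfv N"
  by (induction rule: alpha.induct) (auto simp: rfv_rsubst split: if_splits)

lemma alpha_rsubst_eq: "alpha M N \<Longrightarrow> rsubst M \<sigma> = rsubst N \<sigma>"
proof (induction arbitrary: \<sigma> rule: alpha.induct)
  case (alpha_lam M N x)
  have fv: "rfv M = rfv N" using alpha_lam.hyps by (rule alpha_rfv)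
  show ?case unfolding rsubst.simps(2) fv alpha_lam.IH ..
next
  case (alpha_rename y M x)
  let ?M' = "rsubst M (RVar(x := RVar y))"
  have fv: "rfv ?M' - {y} = rfv M - {x}"
    using alpha_rename by (auto simp: rfv_rsubst split: if_splits)
  have sb: "rsubst ?M' (\<sigma>(y := RVar z)) = rsubst M (\<sigma>(x := RVar z))" for z
    unfolding rsubst_rsubst by (rule rsubst_cong) (use alpha_rename in auto)
  show ?case unfolding rsubst.simps(2) fv sb ..
next
  case (alpha_sym M N)
  show ?case by (rule alpha_sym.IH[symmetric])
next
  case (alpha_trans M N P)
  show ?case by (rule trans[OF alpha_trans.IH])
next
  case (alpha_app M M' N N')
  show ?case unfolding rsubst.simps(3) alpha_app.IH ..
qed (rule refl)

lemma alpha_rsubst_pointwise: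
  "(\<And>y. alpha (\<sigma> y) (\<tau> y)) \<Longrightarrow> alpha (rsubst M \<sigma>) (rsubst M \<tau>)"
proof (induction M arbitrary: \<sigma> \<tau>)
  case (RLam x M)
  have "rfv (\<sigma> y) = rfv (\<tau> y)" for y using RLam.prems alpha_rfv by blast
  moreover have "alpha (rsubst M (\<sigma>(x := RVar z))) (rsubst M (\<tau>(x := RVar z)))" for z
    by (rule RLam.IH) (use RLam.prems in \<open>auto intro: alpha_refl\<close>)
  ultimately show ?case by (simp add: Let_def alpha.alpha_lam)
qed (auto intro: alpha.intros)

quotient_type tm = rtm / alpha
  by (intro equivpI reflpI sympI transpI) (blast intro: alpha.intros)+

lift_definition Var :: "var \<Rightarrow> tm" is RVar .

lift_definition Lam :: "var \<Rightarrow> tm \<Rightarrow> tm" is RLam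
  by (rule alpha_lam)

lift_definition App :: "tm \<Rightarrow> tm \<Rightarrow> tm" is RApp
  by (rule alpha_app)

lift_definition fv :: "tm \<Rightarrow> var set" is rfv
  by (rule alpha_rfv)

lemma finite_fv [simp]: "finite (fv M)"
  by transfer simp

lift_definition subst :: "tm \<Rightarrow> (var \<Rightarrow> tm) \<Rightarrow> tm" is rsubst
  by (simp add: rel_fun_def alpha_rsubst_eq alpha_rsubst_pointwise)

text \<open>\<open>ssubst M [(x\<^sub>1, N\<^sub>1), \<dots>, (x\<^sub>n, N\<^sub>n)]\<close> is \<open>M[(x\<^sub>i := N\<^sub>i)\<^sub>1\<^sup>n]\<close>; it is meant for pairwise distinct
  \<open>x\<^sub>i\<close>.\<close>

definition ssubst :: "tm \<Rightarrow> (var \<times> tm) list \<Rightarrow> tm" where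
  "ssubst M \<rho> = subst M (\<lambda>x. case map_of \<rho> x of None \<Rightarrow> Var x | Some N \<Rightarrow> N)"

inductive beta :: "tm \<Rightarrow> tm \<Rightarrow> bool" where
  beta_redex: "beta (App (Lam x M) N) (ssubst M [(x, N)])"
| beta_lam: "beta M M' \<Longrightarrow> beta (Lam x M) (Lam x M')"
| beta_appL: "beta M M' \<Longrightarrow> beta (App M N) (App M' N)"
| beta_appR: "beta N N' \<Longrightarrow> beta (App M N) (App M N')"

inductive whead :: "tm \<Rightarrow> tm \<Rightarrow> bool" where
  "whead (foldl App (App (Lam x P) Q) Qs) (foldl App (ssubst P [(x, Q)]) Qs)"

datatype strategy = WeakHead | Beta

fun red :: "strategy \<Rightarrow> tm \<Rightarrow> tm \<Rightarrow> bool" where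
  "red WeakHead = whead"
| "red Beta = beta"

type_synonym atom = nat

datatype rty = RAtom atom | RArr ruty rty
  and ruty = ROmega | RInter ruty ruty | REmb rty

text \<open>The least congruence making intersection commutative, associative and idempotent with
  unit \<open>ROmega\<close>.\<close>

inductive ty_eq :: "rty \<Rightarrow> rty \<Rightarrow> bool" and uty_eq :: "ruty \<Rightarrow> ruty \<Rightarrow> bool" where
  ty_refl: "ty_eq T T"
| ty_sym: "ty_eq T T' \<Longrightarrow> ty_eq T' T"
| ty_trans: "ty_eq T T' \<Longrightarrow> ty_eq T' T'' \<Longrightarrow> ty_eq T T''"
| ty_arr: "uty_eq U U' \<Longrightarrow> ty_eq T T' \<Longrightarrow> ty_eq (RArr U T) (RArr U' T')"
| uty_refl: "uty_eq U U"
| uty_sym: "uty_eq U U' \<Longrightarrow> uty_eq U' U"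
| uty_trans: "uty_eq U U' \<Longrightarrow> uty_eq U' U'' \<Longrightarrow> uty_eq U U''"
| uty_inter: "uty_eq U U' \<Longrightarrow> uty_eq V V' \<Longrightarrow> uty_eq (RInter U V) (RInter U' V')"
| uty_emb: "ty_eq T T' \<Longrightarrow> uty_eq (REmb T) (REmb T')"
| uty_comm: "uty_eq (RInter U V) (RInter V U)"
| uty_assoc: "uty_eq (RInter U (RInter V W)) (RInter (RInter U V) W)"
| uty_idem: "uty_eq (RInter U U) U"
| uty_omega: "uty_eq (RInter ROmega U) U"

quotient_type ty = rty / ty_eq
  by (intro equivpI reflpI sympI transpI) (blast intro: ty_eq_uty_eq.intros)+

quotient_type uty = ruty / uty_eq
  by (intro equivpI reflpI sympI transpI) (blast intro: ty_eq_uty_eq.intros)+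

lift_definition Atom :: "atom \<Rightarrow> ty" is RAtom .

lift_definition Arr :: "uty \<Rightarrow> ty \<Rightarrow> ty" is RArr
  by (rule ty_arr)

lift_definition Omega :: uty is ROmega .

lift_definition Inter :: "uty \<Rightarrow> uty \<Rightarrow> uty" (infixl \<open>\<sqinter>\<close> 70) is RInter
  by (rule uty_inter)

text \<open>\<open>Emb\<close> is the inclusion of the arrow and atomic types into all types.\<close>

lift_definition Emb :: "ty \<Rightarrow> uty" is REmb
  by (rule uty_emb)

type_synonym env = "(var, uty) fmap"

definition omega_env :: "tm \<Rightarrow> env" where
  "omega_env M = fmap_of_list (map (\<lambda>x. (x, Omega)) (sorted_list_of_set (fv M)))"

context includes fmap.lifting
begin

lift_definition env_inter :: "env \<Rightarrow> env \<Rightarrow> env" (infixl \<open>\<sqinter>\<^sub>e\<close> 70) is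
  "\<lambda>\<Gamma> \<Delta> x. case \<Gamma> x of
      None \<Rightarrow> \<Delta> x
    | Some U \<Rightarrow> (case \<Delta> x of None \<Rightarrow> Some U | Some V \<Rightarrow> Some (U \<sqinter> V))"
proof -
  fix \<Gamma> \<Delta> :: "var \<rightharpoonup> uty"
  assume "finite (dom \<Gamma>)" "finite (dom \<Delta>)"
  then have fin: "finite (dom \<Gamma> \<union> dom \<Delta>)" by simp
  show "finite (dom (\<lambda>x. case \<Gamma> x of None \<Rightarrow> \<Delta> x
      | Some U \<Rightarrow> (case \<Delta> x of None \<Rightarrow> Some U | Some V \<Rightarrow> Some (U \<sqinter> V))))"
    by (rule finite_subset[OF _ fin]) (auto split: option.splits)
qed

end

lemma fmlookup_env_inter:
  "fmlookup (\<Gamma> \<sqinter>\<^sub>e \<Delta>) x = (case fmlookup \<Gamma> x of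
      None \<Rightarrow> fmlookup \<Delta> x
    | Some U \<Rightarrow> (case fmlookup \<Delta> x of None \<Rightarrow> Some U | Some V \<Rightarrow> Some (U \<sqinter> V)))"
  by (simp add: env_inter.rep_eq)

lemma fmlookup_omega_env: "fmlookup (omega_env M) x = (if x \<in> fv M then Some Omega else None)"
proof -
  have "map_of (map (\<lambda>x. (x, Omega)) xs) x = (if x \<in> set xs then Some Omega else None)" for xs
    by (induction xs) auto
  then show ?thesis by (simp add: omega_env_def fmlookup_of_list)
qed

datatype typing = Typing env uty (\<open>\<langle>_ \<turnstile> _\<rangle>\<close>)

text \<open>Since types, environments and typings are disjoint, the single subtyping relation splits into
  three, each with its own reflexivity and transitivity.\<close>

inductive sub :: "uty \<Rightarrow> uty \<Rightarrow> bool" (infix \<open>\<sqsubseteq>\<close> 50) where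
  sub_refl: "U \<sqsubseteq> U"
| sub_trans: "U \<sqsubseteq> V \<Longrightarrow> V \<sqsubseteq> W \<Longrightarrow> U \<sqsubseteq> W"
| sub_interE: "U1 \<sqinter> U2 \<sqsubseteq> U1"
| sub_inter: "U1 \<sqsubseteq> V1 \<Longrightarrow> U2 \<sqsubseteq> V2 \<Longrightarrow> U1 \<sqinter> U2 \<sqsubseteq> V1 \<sqinter> V2"
| sub_arr: "U2 \<sqsubseteq> U1 \<Longrightarrow> Emb T1 \<sqsubseteq> Emb T2 \<Longrightarrow> Emb (Arr U1 T1) \<sqsubseteq> Emb (Arr U2 T2)"

inductive env_sub :: "env \<Rightarrow> env \<Rightarrow> bool" (infix \<open>\<sqsubseteq>\<^sub>e\<close> 50) where
  env_sub_refl: "\<Gamma> \<sqsubseteq>\<^sub>e \<Gamma>"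
| env_sub_trans: "\<Gamma>1 \<sqsubseteq>\<^sub>e \<Gamma>2 \<Longrightarrow> \<Gamma>2 \<sqsubseteq>\<^sub>e \<Gamma>3 \<Longrightarrow> \<Gamma>1 \<sqsubseteq>\<^sub>e \<Gamma>3"
| env_sub_decl: "U1 \<sqsubseteq> U2 \<Longrightarrow> x \<notin> fmdom' \<Gamma> \<Longrightarrow> fmupd x U1 \<Gamma> \<sqsubseteq>\<^sub>e fmupd x U2 \<Gamma>"

inductive typing_sub :: "typing \<Rightarrow> typing \<Rightarrow> bool" (infix \<open>\<sqsubseteq>\<^sub>t\<close> 50) where
  typing_sub_refl: "\<Phi> \<sqsubseteq>\<^sub>t \<Phi>"
| typing_sub_trans: "\<Phi>1 \<sqsubseteq>\<^sub>t \<Phi>2 \<Longrightarrow> \<Phi>2 \<sqsubseteq>\<^sub>t \<Phi>3 \<Longrightarrow> \<Phi>1 \<sqsubseteq>\<^sub>t \<Phi>3"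
| typing_sub_typing: "U1 \<sqsubseteq> U2 \<Longrightarrow> \<Gamma>2 \<sqsubseteq>\<^sub>e \<Gamma>1 \<Longrightarrow> \<langle>\<Gamma>1 \<turnstile> U1\<rangle> \<sqsubseteq>\<^sub>t \<langle>\<Gamma>2 \<turnstile> U2\<rangle>"

inductive has_type :: "tm \<Rightarrow> typing \<Rightarrow> bool" where
  ax: "has_type (Var x) \<langle>fmupd x (Emb T) fmempty \<turnstile> Emb T\<rangle>"
| omega: "has_type M \<langle>omega_env M \<turnstile> Omega\<rangle>"
| arrI: "has_type M \<langle>fmupd x U \<Gamma> \<turnstile> Emb T\<rangle> \<Longrightarrow> x \<notin> fmdom' \<Gamma> \<Longrightarrow>
    has_type (Lam x M) \<langle>\<Gamma> \<turnstile> Emb (Arr U T)\<rangle>"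
| arrI': "has_type M \<langle>\<Gamma> \<turnstile> Emb T\<rangle> \<Longrightarrow> x \<notin> fmdom' \<Gamma> \<Longrightarrow>
    has_type (Lam x M) \<langle>\<Gamma> \<turnstile> Emb (Arr Omega T)\<rangle>"
| arrE: "has_type M1 \<langle>\<Gamma>1 \<turnstile> Emb (Arr U T)\<rangle> \<Longrightarrow> has_type M2 \<langle>\<Gamma>2 \<turnstile> U\<rangle> \<Longrightarrow>
    has_type (App M1 M2) \<langle>\<Gamma>1 \<sqinter>\<^sub>e \<Gamma>2 \<turnstile> Emb T\<rangle>"
| interI: "has_type M \<langle>\<Gamma> \<turnstile> U1\<rangle> \<Longrightarrow> has_type M \<langle>\<Gamma> \<turnstile> U2\<rangle> \<Longrightarrow> has_type M \<langle>\<Gamma> \<turnstile> U1 \<sqinter> U2\<rangle>"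
| subsum: "has_type M \<langle>\<Gamma> \<turnstile> U\<rangle> \<Longrightarrow> \<langle>\<Gamma> \<turnstile> U\<rangle> \<sqsubseteq>\<^sub>t \<langle>\<Gamma>' \<turnstile> U'\<rangle> \<Longrightarrow> has_type M \<langle>\<Gamma>' \<turnstile> U'\<rangle>"

definition fun_space :: "tm set \<Rightarrow> tm set \<Rightarrow> tm set" (infixr \<open>\<leadsto>\<close> 60) where
  "X \<leadsto> Y = {M. \<forall>N \<in> X. App M N \<in> Y}"

definition saturated :: "strategy \<Rightarrow> tm set \<Rightarrow> bool" where
  "saturated r X \<longleftrightarrow> (\<forall>M N. (red r)\<^sup>*\<^sup>* M N \<longrightarrow> N \<in> X \<longrightarrow> M \<in> X)"

definition interpretation_for :: "strategy \<Rightarrow> (atom \<Rightarrow> tm set) \<Rightarrow> bool" where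
  "interpretation_for r I \<longleftrightarrow> (\<forall>a. saturated r (I a))"

primrec rinterp_ty :: "(atom \<Rightarrow> tm set) \<Rightarrow> rty \<Rightarrow> tm set"
  and rinterp :: "(atom \<Rightarrow> tm set) \<Rightarrow> ruty \<Rightarrow> tm set" where
  "rinterp_ty I (RAtom a) = I a"
| "rinterp_ty I (RArr U T) = (rinterp I U \<leadsto> rinterp_ty I T)"
| "rinterp I ROmega = UNIV"
| "rinterp I (RInter U V) = rinterp I U \<inter> rinterp I V"
| "rinterp I (REmb T) = rinterp_ty I T"

lemma rinterp_respects:
  "ty_eq T T' \<Longrightarrow> rinterp_ty I T = rinterp_ty I T'"
  "uty_eq U U' \<Longrightarrow> rinterp I U = rinterp I U'"
proof (induction rule: ty_eq_uty_eq.inducts)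
  case (ty_arr U U' T T')
  show ?case unfolding rinterp_ty.simps ty_arr.IH ..
next
  case (uty_inter U U' V V')
  show ?case unfolding rinterp.simps uty_inter.IH ..
next
  case (uty_emb T T')
  show ?case unfolding rinterp.simps uty_emb.IH ..
next
  case (ty_sym T T')
  show ?case by (rule ty_sym.IH[symmetric])
next
  case (ty_trans T T' T'')
  show ?case by (rule trans[OF ty_trans.IH])
next
  case (uty_sym U U')
  show ?case by (rule uty_sym.IH[symmetric])
next
  case (uty_trans U U' U'')
  show ?case by (rule trans[OF uty_trans.IH])
qed auto

lift_definition interp :: "(atom \<Rightarrow> tm set) \<Rightarrow> uty \<Rightarrow> tm set" is rinterp
  by (simp add: rinterp_respects)

lemma interp_Atom [simp]: "interp I (Emb (Atom a)) = I a"
  by transfer simp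

lemma interp_Omega [simp]: "interp I Omega = UNIV"
  by transfer simp

lemma interp_Inter [simp]: "interp I (U \<sqinter> V) = interp I U \<inter> interp I V"
  by transfer simp

lemma interp_Arr [simp]: "interp I (Emb (Arr U T)) = (interp I U \<leadsto> interp I (Emb T))"
  by transfer simp

end

(* Strengthen the claim to arbitrary substitutions: if \<sigma> x lies in the interpretation of the type
   declared for x whenever x is in the domain of the environment, then the instance of M by \<sigma> lies in
   the interpretation of its type. Variables outside the domain are unconstrained, so the two rules
   for abstraction are treated alike: the instance of an abstraction applied to N contracts, at the
   head, to the instance of the body by \<sigma>(x := N), and all interpretations are saturated. *)

theory Submission
  imports Defs
begin

text \<open>\<open>rsubst\<close> may rename binders even under the identity substitution, so raw
  terms need not be equal, only related by \<open>alpha\<close>.\<close>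

lemma alpha_rsubst_RVar: "alpha (rsubst M RVar) M"
proof (induction M)
  case (RLam x M)
  let ?A = "\<Union>y \<in> rfv M - {x}. rfv (RVar y)"
  define z where "z = fresh ?A"
  have "z \<notin> ?A" unfolding z_def by (rule fresh_notin) simp
  \<comment> \<open>Either the binder keeps its name, or the side condition of
    \<open>alpha_rename\<close> holds.\<close>
  then have z: "z = x \<or> z \<notin> rfv M" by auto
  have "alpha (RLam z (rsubst M (RVar(x := RVar z)))) (RLam x M)"
  proof (cases "z = x")
    case True
    then show ?thesis using RLam.IH by (simp add: alpha_lam)
  next
    case False
    then show ?thesis using z by (blast intro: alpha_sym alpha_rename)
  qed
  then show ?case unfolding rsubst.simps Let_def z_def .
qed (auto intro: alpha.intros)

lemma subst_Var_id [simp]: "subst M Var = M"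
  by transfer (rule alpha_rsubst_RVar)

lemma subst_Var [simp]: "subst (Var x) \<sigma> = \<sigma> x"
  by transfer (simp add: alpha_refl)

lemma subst_App [simp]: "subst (App M N) \<sigma> = App (subst M \<sigma>) (subst N \<sigma>)"
  by transfer (simp add: alpha_refl)

lemma subst_cong:
  assumes "\<And>y. y \<in> fv M \<Longrightarrow> \<sigma> y = \<tau> y"
  shows "subst M \<sigma> = subst M \<tau>"
proof -
  \<comment> \<open>Transferring the premise itself would weaken its equality to
    \<open>alpha\<close>, too little for \<open>rsubst_cong\<close>. An unconditional normalisation
    off the free variables transfers safely.\<close>
  have restrict: "subst M (\<lambda>y. if y \<in> fv M then \<rho> y else Var y) = subst M \<rho>" for \<rho>
  proof (transfer, goal_cases)
    case (1 M \<rho>)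
    have "rsubst M (\<lambda>y. if y \<in> rfv M then \<rho> y else RVar y) = rsubst M \<rho>"
      by (rule rsubst_cong) simp
    then show ?case by (simp add: alpha_refl)
  qed
  have "(\<lambda>y. if y \<in> fv M then \<sigma> y else Var y) = (\<lambda>y. if y \<in> fv M then \<tau> y else Var y)"
    using assms by auto
  then show ?thesis by (metis restrict)
qed

lemma subst_subst: "subst (subst M \<sigma>) \<tau> = subst M (\<lambda>y. subst (\<sigma> y) \<tau>)"
  by transfer (simp add: rsubst_rsubst alpha_refl)

lemma subst_Lam:
  "subst (Lam x M) \<sigma> =
     (let z = fresh (\<Union>y \<in> fv M - {x}. fv (\<sigma> y)) in Lam z (subst M (\<sigma>(x := Var z))))"
  by transfer (simp add: alpha_refl Let_def)

lemma ssubst_single: "ssubst M [(x, N)] = subst M (Var(x := N))"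
  unfolding ssubst_def by (rule arg_cong[where f = "subst M"]) auto

lemma red_redex: "red r (App (Lam x M) N) (ssubst M [(x, N)])"
  using beta_redex whead.intros[where Qs = "[]"] by (cases r) auto

text \<open>Contracting the renamed binder \<open>z\<close> composes two substitutions; by freshness
  of \<open>z\<close> the composite agrees with \<open>\<sigma>(x := N)\<close> on the free
  variables of \<open>M\<close>.\<close>

lemma red_subst_Lam: "red r (App (subst (Lam x M) \<sigma>) N) (subst M (\<sigma>(x := N)))"
proof -
  define A where "A = (\<Union>y \<in> fv M - {x}. fv (\<sigma> y))"
  define z where "z = fresh A"
  have z: "z \<notin> A" unfolding z_def by (rule fresh_notin) (simp add: A_def)
  have "ssubst (subst M (\<sigma>(x := Var z))) [(z, N)] = subst M (\<sigma>(x := N))"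
    unfolding ssubst_single subst_subst
  proof (rule subst_cong)
    fix y assume y: "y \<in> fv M"
    show "subst ((\<sigma>(x := Var z)) y) (Var(z := N)) = (\<sigma>(x := N)) y"
    proof (cases "y = x")
      case False
      \<comment> \<open>\<open>z\<close> is not free in \<open>\<sigma> y\<close>, so
        \<open>Var(z := N)\<close> acts there as the identity.\<close>
      then have "subst (\<sigma> y) (Var(z := N)) = subst (\<sigma> y) Var"
        using y z by (intro subst_cong) (auto simp: A_def)
      then show ?thesis using False by simp
    qed simp
  qed
  moreover have "subst (Lam x M) \<sigma> = Lam z (subst M (\<sigma>(x := Var z)))"
    unfolding subst_Lam Let_def z_def A_def ..
  ultimately show ?thesis using red_redex by metis
qed

lemma red_App: "red r M M' \<Longrightarrow> red r (App M N) (App M' N)"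
proof (cases r)
  case WeakHead
  assume "red r M M'"
  with WeakHead have "whead M M'" by simp
  then have "whead (App M N) (App M' N)"
  proof cases
    case (1 x P Q Qs)
    \<comment> \<open>The extra argument joins the end of the spine.\<close>
    then show ?thesis using whead.intros[of x P Q "Qs @ [N]"] by simp
  qed
  with WeakHead show ?thesis by simp
qed (simp add: beta_appL)

text \<open>A reduction of functions lifts to their applications to a fixed argument, where
  saturation of the codomain applies.\<close>

lemma saturated_fun_space:
  assumes "saturated r Y"
  shows "saturated r (X \<leadsto> Y)"
proof -
  have "(red r)\<^sup>*\<^sup>* (App M P) (App N P)" if "(red r)\<^sup>*\<^sup>* M N" for M N P
    using that by induction (auto intro: red_App rtranclp.rtrancl_into_rtrancl)
  then show ?thesis
    using assms unfolding saturated_def fun_space_def by blast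
qed

text \<open>Stated for raw types, where structural induction is available; the quotient version
  follows by transfer.\<close>

lemma saturated_rinterp:
  assumes "interpretation_for r I"
  shows "saturated r (rinterp_ty I T)" and "saturated r (rinterp I U)"
proof (induction T and U)
  case (RAtom a)
  then show ?case using assms by (simp add: interpretation_for_def)
next
  case (RArr U T)
  then show ?case by (simp add: saturated_fun_space)
next
  case (RInter U V)
  then show ?case by (auto simp: saturated_def)
qed (simp_all add: saturated_def)

lemma saturated_interp: "interpretation_for r I \<Longrightarrow> saturated r (interp I U)"
  by transfer (rule saturated_rinterp)

lemma interp_expansion:
  assumes "interpretation_for r I" and "red r M N" and "N \<in> interp I U"
  shows "M \<in> interp I U"
  using saturated_interp[OF assms(1)] assms(2,3) unfolding saturated_def by blast

text \<open>Type intersections become set intersections, and \<open>\<leadsto>\<close> is antitone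
  in its first argument and monotone in its second.\<close>

lemma interp_mono: "U \<sqsubseteq> V \<Longrightarrow> interp I U \<subseteq> interp I V"
  by (induction rule: sub.induct) (auto simp: fun_space_def)

definition satisfies :: "(atom \<Rightarrow> tm set) \<Rightarrow> (var \<Rightarrow> tm) \<Rightarrow> env \<Rightarrow> bool" where
  "satisfies I \<sigma> \<Gamma> \<longleftrightarrow> (\<forall>x U. fmlookup \<Gamma> x = Some U \<longrightarrow> \<sigma> x \<in> interp I U)"

text \<open>Splits the hypothesis of \<open>arrE\<close> between its premises: a variable declared
  on both sides gets an intersection type, hence an intersection of sets.\<close>

lemma satisfies_env_inter:
  "satisfies I \<sigma> (\<Gamma> \<sqinter>\<^sub>e \<Delta>) \<longleftrightarrow> satisfies I \<sigma> \<Gamma> \<and> satisfies I \<sigma> \<Delta>"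
proof -
  have "(\<forall>U. fmlookup (\<Gamma> \<sqinter>\<^sub>e \<Delta>) x = Some U \<longrightarrow> \<sigma> x \<in> interp I U) \<longleftrightarrow>
      (\<forall>U. fmlookup \<Gamma> x = Some U \<longrightarrow> \<sigma> x \<in> interp I U) \<and>
      (\<forall>U. fmlookup \<Delta> x = Some U \<longrightarrow> \<sigma> x \<in> interp I U)" for x
    by (auto simp: fmlookup_env_inter split: option.splits)
  then show ?thesis unfolding satisfies_def by blast
qed

lemma satisfies_mono: "\<Gamma> \<sqsubseteq>\<^sub>e \<Delta> \<Longrightarrow> satisfies I \<sigma> \<Gamma> \<Longrightarrow> satisfies I \<sigma> \<Delta>"
proof (induction rule: env_sub.induct)
  case (env_sub_decl U1 U2 x \<Gamma>)
  then show ?case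
    using interp_mono[OF env_sub_decl.hyps(1), of I]
    by (auto simp: satisfies_def split: if_splits)
qed auto

lemma satisfies_upd:
  assumes "satisfies I \<sigma> \<Gamma>" and "x \<notin> fmdom' \<Gamma>"
  shows "satisfies I (\<sigma>(x := N)) \<Gamma>"
  using assms by (auto simp: satisfies_def fmlookup_dom'_iff)

text \<open>Reflexivity and transitivity of typings add nothing new, as both components already have
  them.\<close>

lemma typing_sub_sound:
  "\<langle>\<Gamma> \<turnstile> U\<rangle> \<sqsubseteq>\<^sub>t \<langle>\<Gamma>' \<turnstile> U'\<rangle> \<Longrightarrow> \<Gamma>' \<sqsubseteq>\<^sub>e \<Gamma> \<and> U \<sqsubseteq> U'"
proof (induction "\<langle>\<Gamma> \<turnstile> U\<rangle>" "\<langle>\<Gamma>' \<turnstile> U'\<rangle>" arbitrary: \<Gamma> U \<Gamma>' U' rule: typing_sub.induct)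
  case (typing_sub_trans \<Phi>2)
  \<comment> \<open>The intermediate typing must be split into its components before the induction
    hypotheses apply.\<close>
  then show ?case by (cases \<Phi>2) (blast intro: env_sub_trans sub_trans)
qed (auto intro: env_sub_refl sub_refl)

lemma has_type_sound:
  assumes "interpretation_for r I"
  shows "has_type M \<langle>\<Gamma> \<turnstile> U\<rangle> \<Longrightarrow> satisfies I \<sigma> \<Gamma> \<Longrightarrow> subst M \<sigma> \<in> interp I U"
\<comment> \<open>\<open>\<sigma>\<close> is generalised because abstractions need the induction
  hypothesis at \<open>\<sigma>(x := N)\<close>.\<close>
proof (induction M "\<langle>\<Gamma> \<turnstile> U\<rangle>" arbitrary: \<Gamma> U \<sigma> rule: has_type.induct)
  case (arrI M x U \<Gamma> T)
  have "App (subst (Lam x M) \<sigma>) N \<in> interp I (Emb T)" if "N \<in> interp I U" for N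
  proof (rule interp_expansion[OF assms red_subst_Lam], rule arrI.hyps(2))
    show "satisfies I (\<sigma>(x := N)) (fmupd x U \<Gamma>)"
      using arrI.prems that
      by (auto simp: satisfies_def)
  qed
  then show ?case by (simp add: fun_space_def)
next
  case (arrI' M \<Gamma> T x)
  \<comment> \<open>\<open>N\<close> is arbitrary because \<open>Omega\<close> is interpreted as the
    set of all terms.\<close>
  have "App (subst (Lam x M) \<sigma>) N \<in> interp I (Emb T)" for N
    by (rule interp_expansion[OF assms red_subst_Lam], rule arrI'.hyps(2))
      (rule satisfies_upd[OF arrI'.prems arrI'.hyps(3)])
  then show ?case by (simp add: fun_space_def)
next
  case (arrE M1 \<Gamma>1 U T M2 \<Gamma>2)
  then have "subst M1 \<sigma> \<in> interp I (Emb (Arr U T))" "subst M2 \<sigma> \<in> interp I U"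
    by (auto simp: satisfies_env_inter)
  then show ?case by (simp add: fun_space_def)
next
  case (subsum M \<Gamma> U \<Gamma>' U')
  \<comment> \<open>Environments are contravariant: \<open>\<sigma>\<close> satisfies
    \<open>\<Gamma>'\<close>, hence also \<open>\<Gamma>\<close>.\<close>
  then have "\<Gamma>' \<sqsubseteq>\<^sub>e \<Gamma>" "U \<sqsubseteq> U'" by (auto dest: typing_sub_sound)
  then show ?case
    using subsum.hyps(2) subsum.prems satisfies_mono interp_mono by blast
qed (auto simp: satisfies_def)

theorem theorem4p6:
  fixes r :: strategy and M :: tm and U :: uty and I :: "atom \<Rightarrow> tm set"
    and n :: nat and xs :: "var list" and Us :: "uty list" and Ns :: "tm list"
  assumes "length xs = n" and "length Us = n" and "length Ns = n"
    and "distinct xs"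
    and "has_type M \<langle>fmap_of_list (zip xs Us) \<turnstile> U\<rangle>"
    and "interpretation_for r I"
    and "\<And>i. i < n \<Longrightarrow> Ns ! i \<in> interp I (Us ! i)"
  shows "ssubst M (zip xs Ns) \<in> interp I U"
proof -
  let ?\<sigma> = "\<lambda>x. case map_of (zip xs Ns) x of None \<Rightarrow> Var x | Some N \<Rightarrow> N"
  have "satisfies I ?\<sigma> (fmap_of_list (zip xs Us))"
    unfolding satisfies_def
  proof (intro allI impI)
    fix x V assume "fmlookup (fmap_of_list (zip xs Us)) x = Some V"
    then have "(x, V) \<in> set (zip xs Us)"
      by (simp add: fmlookup_of_list map_of_SomeD)
    then obtain i where i: "i < n" "x = xs ! i" "V = Us ! i"
      using assms(1,2) by (auto simp: set_zip)
    \<comment> \<open>Distinctness of \<open>xs\<close> ensures that the lookup finds position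
      \<open>i\<close> and no earlier one.\<close>
    then have "map_of (zip xs Ns) x = Some (Ns ! i)"
      using assms(1,3,4) by (simp add: map_of_zip_nth)
    then show "?\<sigma> x \<in> interp I V" using assms(7) i by simp
  qed
  then show ?thesis
    unfolding ssubst_def by (rule has_type_sound[OF assms(6,5)])
qed

end
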